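(* Let $1<\alpha<2$, $0<d<1-\frac1\alpha$, let $g:\mathbb{R}\to\mathbb{R}$ be a measurable function such that $g(t)=0$ for all $t<0$ and $|g(t)|\le C_0e^{-ct}$ for some constants $C_0>0$ and $c>0$, and let $Y_d(t)=\int_{-\infty}^{t}(I_+^dg)(t-x)\,dL_\alpha(x)$, $t\in\mathbb{R}$, be the FIMA Stable process. For $\theta_1,\theta_2\in\mathbb{R}$ let $$r(t)=r(\theta_1,\theta_2;t)=\mathbb{E}\big[e^{i(\theta_1Y_d(t)+\theta_2Y_d(0))}\big]-\mathbb{E}\big[e^{i\theta_1Y_d(t)}\big]\,\mathbb{E}\big[e^{i\theta_2Y_d(0)}\big].$$ Then, as $t\to-\infty$, $$r(t)\sim-KC|t|^{\alpha(d-1)+1},\qquad\text{i.e.}\qquad\lim_{t\to-\infty}|t|^{\alpha(1-d)-1}\,r(t)=-KC,$$ where $$K=\exp\left\{-\frac{|\theta_1|^\alpha+|\theta_2|^\alpha}{\Gamma(d)^\alpha}\int_{-\infty}^0\left|\int_x^0g(-u)(u-x)^{d-1}du\right|^\alpha dx\right\}$$ and $$C=\left|\frac1{\Gamma(d)}\int_0^\infty g(u)\,du\right|^\alpha\int_1^\infty\Big(\left|\theta_1(x-1)^{d-1}+\theta_2x^{d-1}\right|^\alpha-\left|\theta_1(x-1)^{d-1}\right|^\alpha-\left|\theta_2x^{d-1}\right|^\alpha\Big)dx.$$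
   Context: $\{L_\alpha(t)\}_{t\in\mathbb{R}}$ is a symmetric $\alpha$-stable ($S\alpha S$) process with Lebesgue control measure. The stable integral $f\mapsto\int_{\mathbb{R}}f\,dL_\alpha$ is the associated linear map from $L^\alpha(\mathbb{R})$ to random variables, with $\mathbb{E}[\exp\{i\theta\int f\,dL_\alpha\}]=\exp\{-|\theta|^\alpha\int_{\mathbb{R}}|f(x)|^\alpha dx\}$ for $\theta\in\mathbb{R}$; and $\int_{-\infty}^tf\,dL_\alpha$ means $\int_{\mathbb{R}}\mathbf 1_{(-\infty,t]}f\,dL_\alpha$. The left-sided Riemann-Liouville fractional integral is $(I_+^dg)(x)=\frac1{\Gamma(d)}\int_{-\infty}^xg(t)(x-t)^{d-1}dt$. *)

theory Defs
  imports "HOL-Probability.Probability"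
begin

text \<open>The normalisation of an \<open>S\<alpha>S\<close> law is that of the characteristic function
  \<open>exp (- \<sigma>\<^sup>\<alpha> \<bar>\<theta>\<bar>\<^sup>\<alpha>)\<close>, and Lebesgue control measure means that the increment over an interval
  has \<open>\<sigma>\<^sup>\<alpha>\<close> equal to the length of that interval.\<close>

definition sas_process :: "'w measure \<Rightarrow> real \<Rightarrow> (real \<Rightarrow> 'w \<Rightarrow> real) \<Rightarrow> bool" where
  "sas_process M \<alpha> L \<longleftrightarrow>
     prob_space M \<and>
     (\<forall>t. L t \<in> borel_measurable M) \<and>
     (AE \<omega> in M. L 0 \<omega> = 0) \<and>
     (\<forall>(n::nat) (t::nat \<Rightarrow> real). mono t \<longrightarrow>
        prob_space.indep_vars M (\<lambda>_. borel) (\<lambda>i \<omega>. L (t (Suc i)) \<omega> - L (t i) \<omega>) {..<n}) \<and>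
     (\<forall>s t \<theta>. s \<le> t \<longrightarrow>
        (CLINT \<omega>|M. iexp (\<theta> * (L t \<omega> - L s \<omega>)))
          = complex_of_real (exp (- ((t - s) * \<bar>\<theta>\<bar> powr \<alpha>))))"

definition Lp_real :: "real \<Rightarrow> (real \<Rightarrow> real) set" where
  "Lp_real p = {f. f \<in> borel_measurable lebesgue \<and> integrable lebesgue (\<lambda>x. \<bar>f x\<bar> powr p)}"

text \<open>\<open>J f\<close> is \<open>\<integral> f dL\<close>. Random variables are only determined almost surely, so linearity and
  the compatibility with the increments of \<open>L\<close> are required almost surely. Outside
  \<open>Lp_real \<alpha>\<close> the value of \<open>J\<close> is irrelevant.\<close>

definition stable_integral ::
    "'w measure \<Rightarrow> real \<Rightarrow> (real \<Rightarrow> 'w \<Rightarrow> real) \<Rightarrow> ((real \<Rightarrow> real) \<Rightarrow> 'w \<Rightarrow> real) \<Rightarrow> bool" where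
  "stable_integral M \<alpha> L J \<longleftrightarrow>
     (\<forall>f\<in>Lp_real \<alpha>. J f \<in> borel_measurable M) \<and>
     (\<forall>f\<in>Lp_real \<alpha>. \<forall>g\<in>Lp_real \<alpha>. \<forall>a b.
        AE \<omega> in M. J (\<lambda>x. a * f x + b * g x) \<omega> = a * J f \<omega> + b * J g \<omega>) \<and>
     (\<forall>s t. s \<le> t \<longrightarrow> (AE \<omega> in M. J (indicator {s<..t}) \<omega> = L t \<omega> - L s \<omega>)) \<and>
     (\<forall>f\<in>Lp_real \<alpha>. \<forall>\<theta>.
        (CLINT \<omega>|M. iexp (\<theta> * J f \<omega>))
          = complex_of_real (exp (- (\<bar>\<theta>\<bar> powr \<alpha> * (LINT x|lebesgue. \<bar>f x\<bar> powr \<alpha>)))))"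

definition frac_integral :: "real \<Rightarrow> (real \<Rightarrow> real) \<Rightarrow> real \<Rightarrow> real" where
  "frac_integral d g x =
     1 / Gamma d * (LINT t:{..x}|lebesgue. g t * (x - t) powr (d - 1))"

definition fima_process ::
    "((real \<Rightarrow> real) \<Rightarrow> 'w \<Rightarrow> real) \<Rightarrow> real \<Rightarrow> (real \<Rightarrow> real) \<Rightarrow> real \<Rightarrow> 'w \<Rightarrow> real" where
  "fima_process J d g t = J (\<lambda>x. indicator {..t} x * frac_integral d g (t - x))"

definition dependence_r ::
    "'w measure \<Rightarrow> (real \<Rightarrow> 'w \<Rightarrow> real) \<Rightarrow> real \<Rightarrow> real \<Rightarrow> real \<Rightarrow> complex" where
  "dependence_r M Y \<theta>\<^sub>1 \<theta>\<^sub>2 t =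
     (CLINT \<omega>|M. iexp (\<theta>\<^sub>1 * Y t \<omega> + \<theta>\<^sub>2 * Y 0 \<omega>))
     - (CLINT \<omega>|M. iexp (\<theta>\<^sub>1 * Y t \<omega>)) * (CLINT \<omega>|M. iexp (\<theta>\<^sub>2 * Y 0 \<omega>))"

end

theory Submission imports Defs "HOL-Real_Asymp.Real_Asymp" begin

text \<open>With \<open>G = I\<^sub>+\<^sup>d g\<close>, the stable characteristic functions give
  \<open>r(t) = K (exp (- I(t)) - 1)\<close>, where \<open>I(t)\<close> integrates the defect
  \<open>\<bar>a + b\<bar>\<^sup>\<alpha> - \<bar>a\<bar>\<^sup>\<alpha> - \<bar>b\<bar>\<^sup>\<alpha>\<close> at \<open>a = \<theta>\<^sub>1 G(t - x)\<close>, \<open>b = \<theta>\<^sub>2 G(- x)\<close>. Substituting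
  \<open>x = t z\<close> and using that the defect is homogeneous of degree \<open>\<alpha>\<close>, \<open>\<bar>t\<bar>\<^bsup>\<alpha>(1 - d) - 1\<^esup> I(t)\<close> becomes an
  integral over \<open>z > 1\<close> of the defect at rescaled values of \<open>G\<close>. Since \<open>y\<^bsup>1 - d\<^esup> G(y)\<close> is bounded on
  \<open>y > 0\<close> and tends to \<open>\<integral> g / \<Gamma>(d)\<close>, dominated convergence yields the limit \<open>C\<close>; as \<open>I(t)\<close> itself
  tends to 0, \<open>exp (- I(t)) - 1\<close> may be replaced by \<open>- I(t)\<close>. Measurability of \<open>G\<close> is obtained by
  first replacing \<open>g\<close> by a Borel function that agrees with it almost everywhere and satisfies the
  same bounds everywhere.\<close>

subsection \<open>The additivity defect of the power function\<close>

lemma powr_diff_le: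
  fixes x y p :: real
  assumes "0 \<le> y" "y \<le> x" "1 \<le> p"
  shows "x powr p - y powr p \<le> p * x powr (p - 1) * (x - y)"
proof (cases "y = x")
  case False
  have "\<exists>l z. y < z \<and> z < x \<and> ((\<lambda>z. z powr p) has_real_derivative l) (at z) \<and>
      x powr p - y powr p = (x - y) * l"
  proof (rule MVT)
    show "continuous_on {y..x} (\<lambda>z. z powr p)"
      using assms by (intro continuous_intros continuous_on_powr') auto
    fix z assume "y < z" "z < x"
    then show "(\<lambda>z. z powr p) differentiable (at z)"
      using assms has_real_derivative_powr[of z p] by (auto simp: real_differentiable_def)
  qed (use False assms in auto)
  then obtain l z where z: "y < z" "z < x" and l: "((\<lambda>z. z powr p) has_real_derivative l) (at z)"
    and eq: "x powr p - y powr p = (x - y) * l" by blast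
  have "l = p * z powr (p - 1)"
    using l z assms by (intro DERIV_unique[OF l has_real_derivative_powr]) auto
  also have "\<dots> \<le> p * x powr (p - 1)"
    using z assms by (intro mult_left_mono powr_mono2) auto
  finally show ?thesis
    using eq assms by (metis diff_ge_0_iff_ge mult.commute mult_left_mono)
qed auto

text \<open>From \<open>x + y \<le> 2 * max x y\<close>. The crude constant \<open>2 powr p\<close>
  serves exponents below 1, such as \<alpha> - 1, as well as above.\<close>

lemma powr_add_le:
  fixes x y p :: real
  assumes "0 \<le> x" "0 \<le> y" "0 \<le> p"
  shows "(x + y) powr p \<le> 2 powr p * (x powr p + y powr p)"
proof -
  have "(x + y) powr p \<le> (2 * max x y) powr p"
    using assms by (intro powr_mono2) auto
  also have "\<dots> = 2 powr p * (max x y) powr p"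
    using assms by (simp add: powr_mult)
  also have "\<dots> \<le> 2 powr p * (x powr p + y powr p)"
    by (intro mult_left_mono) (auto simp: max_def)
  finally show ?thesis .
qed

text \<open>A codifference integrand: with characteristic functions written as
  \<open>exp (- E)\<close>, its integral over the values of two kernels is the joint
  \<open>E\<close> minus the two marginal ones.\<close>

definition codiff :: "real \<Rightarrow> real \<Rightarrow> real \<Rightarrow> real" where
  "codiff p a b = \<bar>a + b\<bar> powr p - \<bar>a\<bar> powr p - \<bar>b\<bar> powr p"

lemma codiff_0_left [simp]: "codiff p 0 b = 0"
  by (simp add: codiff_def)

text \<open>Lets the factor \<open>T powr (1 - d)\<close> be moved into the defect and the limit
  constant be taken out of it.\<close>

lemma codiff_mult: "codiff p (k * a) (k * b) = \<bar>k\<bar> powr p * codiff p a b"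
proof -
  have "\<bar>k * a + k * b\<bar> = \<bar>k\<bar> * \<bar>a + b\<bar>"
    by (simp flip: abs_mult add: distrib_left)
  then show ?thesis
    by (simp add: codiff_def abs_mult powr_mult algebra_simps)
qed

lemma measurable_codiff [measurable]:
  assumes [measurable]: "f \<in> borel_measurable N" "g \<in> borel_measurable N"
  shows "(\<lambda>x. codiff p (f x) (g x)) \<in> borel_measurable N"
  unfolding codiff_def by measurable

lemma tendsto_codiff:
  assumes "(f \<longlongrightarrow> a) F" "(g \<longlongrightarrow> b) F" "0 < p"
  shows "((\<lambda>x. codiff p (f x) (g x)) \<longlongrightarrow> codiff p a b) F"
  unfolding codiff_def
  using assms by (intro tendsto_diff tendsto_powr' tendsto_rabs tendsto_add tendsto_const) auto

text \<open>The first summand is what saves integrability where \<open>a\<close> has a singularity that is not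
  \<open>p\<close>-integrable: only the power \<open>p - 1\<close> of \<open>a\<close> enters.\<close>

lemma abs_codiff_le:
  assumes "1 \<le> p"
  shows "\<bar>codiff p a b\<bar> \<le>
    (p * 2 powr (p - 1) + 1) * (\<bar>a\<bar> powr (p - 1) * \<bar>b\<bar> + \<bar>b\<bar> powr p)"
proof -
  \<comment> \<open>Stated for an ordered pair because \<open>\<bar>a + b\<bar>\<close> may lie on
    either side of \<open>\<bar>a\<bar>\<close>; in both cases the gap is at most
    \<open>\<bar>b\<bar>\<close>.\<close>
  have diff: "\<bar>x powr p - y powr p\<bar> \<le> p * (\<bar>a\<bar> + \<bar>b\<bar>) powr (p - 1) * \<bar>b\<bar>"
    if "0 \<le> y" "y \<le> x" "x \<le> \<bar>a\<bar> + \<bar>b\<bar>" "x - y \<le> \<bar>b\<bar>" for x y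
  proof -
    have "\<bar>x powr p - y powr p\<bar> = x powr p - y powr p"
      using that assms powr_mono2[of p y x] by simp
    also have "\<dots> \<le> p * x powr (p - 1) * (x - y)"
      using powr_diff_le that assms by simp
    also have "\<dots> \<le> p * (\<bar>a\<bar> + \<bar>b\<bar>) powr (p - 1) * \<bar>b\<bar>"
      using that assms by (intro mult_mono mult_left_mono powr_mono2) auto
    finally show ?thesis .
  qed
  have "\<bar>\<bar>a + b\<bar> powr p - \<bar>a\<bar> powr p\<bar> \<le> p * (\<bar>a\<bar> + \<bar>b\<bar>) powr (p - 1) * \<bar>b\<bar>"
  proof (cases "\<bar>a\<bar> \<le> \<bar>a + b\<bar>")
    case True
    then show ?thesis by (intro diff) auto
  next
    case False
    then show ?thesis by (subst abs_minus_commute, intro diff) auto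
  qed
  also have "\<dots> \<le> p * (2 powr (p - 1) * (\<bar>a\<bar> powr (p - 1) + \<bar>b\<bar> powr (p - 1))) * \<bar>b\<bar>"
    using assms by (intro mult_right_mono mult_left_mono powr_add_le) auto
  also have "\<dots> = p * 2 powr (p - 1) * (\<bar>a\<bar> powr (p - 1) * \<bar>b\<bar> + \<bar>b\<bar> powr p)"
    by (cases "b = 0") (auto simp: algebra_simps powr_diff)
  finally have "\<bar>codiff p a b\<bar> \<le>
      p * 2 powr (p - 1) * (\<bar>a\<bar> powr (p - 1) * \<bar>b\<bar> + \<bar>b\<bar> powr p) + \<bar>b\<bar> powr p"
    using powr_ge_zero[of "\<bar>b\<bar>" p] unfolding codiff_def by linarith
  also have "\<dots> \<le> (p * 2 powr (p - 1) + 1) * (\<bar>a\<bar> powr (p - 1) * \<bar>b\<bar> + \<bar>b\<bar> powr p)"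
    by (simp add: algebra_simps)
  finally show ?thesis .
qed

subsection \<open>Integrals of powers and exponentials\<close>

text \<open>Turns a gauge integral into a Lebesgue integral: nonnegativity makes it absolutely
  convergent, and uniqueness of the gauge integral fixes the value.\<close>

lemma has_bochner_integral_lborel_nonneg:
  fixes f :: "real \<Rightarrow> real"
  assumes f: "(f has_integral I) A" and nonneg: "\<And>x. x \<in> A \<Longrightarrow> 0 \<le> f x"
    and meas: "(\<lambda>x. indicator A x * f x) \<in> borel_measurable borel"
  shows "has_bochner_integral lborel (\<lambda>x. indicator A x * f x) I"
proof -
  have "f absolutely_integrable_on A"
    using assms by (intro nonnegative_absolutely_integrable_1) auto
  then have int: "integrable lborel (\<lambda>x. indicator A x * f x)"
    using meas by (simp add: set_integrable_def integrable_completion)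
  have "((\<lambda>x. indicator A x * f x) has_integral I) UNIV"
    using f by (subst (asm) has_integral_restrict_UNIV[symmetric])
      (simp add: indicator_def of_bool_def if_distrib[of "\<lambda>u. u * _"] cong: if_cong)
  then show ?thesis
    using has_integral_integral_lborel[OF int] int
    by (auto simp: has_bochner_integral_iff intro: has_integral_unique)
qed

lemma has_bochner_integral_powr_from_0:
  fixes e c :: real
  assumes "e > -1" "c \<ge> 0"
  shows "has_bochner_integral lborel (\<lambda>x. indicator {0..c} x * x powr e) (c powr (e + 1) / (e + 1))"
  using assms by (intro has_bochner_integral_lborel_nonneg has_integral_powr_from_0) auto

lemma integrable_powr_to_inf:
  fixes e a :: real
  assumes "e < -1" "a > 0"
  shows "integrable lborel (\<lambda>x. indicator {a..} x * x powr e)"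
  by (rule integrable.intros[OF has_bochner_integral_lborel_nonneg[OF has_integral_powr_to_inf[OF assms]]])
    auto

text \<open>Up to 2 the factor \<open>x powr (- q)\<close> is at most 1 and \<open>p < 1\<close>
  makes the singularity integrable. Beyond 2, \<open>x - 1 \<ge> x / 2\<close> reduces the product
  to a multiple of \<open>x powr (- (p + q))\<close>.\<close>

lemma integrable_shifted_powr_mult:
  fixes p q :: real
  assumes "0 \<le> p" "p < 1" "0 \<le> q" "1 < p + q"
  shows "integrable lborel (\<lambda>x. indicator {1<..} x * ((x - 1) powr (- p) * x powr (- q)))"
proof (rule Bochner_Integration.integrable_bound)
  have "integrable lborel (\<lambda>x. indicator {0..1} (-1 + 1 * x) * (-1 + 1 * x) powr (- p))"
    using has_bochner_integral_powr_from_0[of "-p" 1] assms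
    by (intro lborel_integrable_real_affine) (auto simp: has_bochner_integral_iff)
  moreover have "integrable lborel (\<lambda>x. indicator {1..} x * x powr (- (p + q)))"
    using assms by (intro integrable_powr_to_inf) auto
  ultimately show "integrable lborel (\<lambda>x. indicator {0..1} (-1 + 1 * x) * (-1 + 1 * x) powr (- p)
      + 2 powr p * (indicator {1..} x * x powr (- (p + q))) :: real)"
    by (intro Bochner_Integration.integrable_add integrable_mult_right)
  show "AE x in lborel. norm (indicator {1<..} x * ((x - 1) powr (- p) * x powr (- q))) \<le>
     norm (indicator {0..1} (-1 + 1 * x) * (-1 + 1 * x) powr (- p)
      + 2 powr p * (indicator {1..} x * x powr (- (p + q))) :: real)"
  proof (rule AE_I2)
    fix x :: real
    consider "x \<le> 1" | "1 < x" "x \<le> 2" | "2 < x" by linarith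
    then show "norm (indicator {1<..} x * ((x - 1) powr (- p) * x powr (- q))) \<le>
     norm (indicator {0..1} (-1 + 1 * x) * (-1 + 1 * x) powr (- p)
      + 2 powr p * (indicator {1..} x * x powr (- (p + q))) :: real)"
    proof cases
      case 2
      have "x powr (- q) \<le> x powr 0"
        using 2 assms by (intro powr_mono) auto
      then have "(x - 1) powr (- p) * x powr (- q) \<le> (x - 1) powr (- p) * 1"
        using 2 by (intro mult_left_mono) auto
      then show ?thesis using 2 by (simp add: add_increasing2)
    next
      case 3
      have "(x - 1) powr (- p) \<le> (x / 2) powr (- p)"
        using 3 assms by (intro powr_mono2') auto
      then have "(x - 1) powr (- p) * x powr (- q) \<le> (x / 2) powr (- p) * x powr (- q)"
        by (intro mult_right_mono) auto
      also have "\<dots> = 2 powr p * x powr (- (p + q))"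
        using 3 powr_add[of x "-p" "-q"] by (simp add: powr_divide powr_minus field_simps)
      finally show ?thesis using 3 by simp
    qed auto
  qed
qed measurable

lemma integrable_exp_bounded:
  fixes g :: "real \<Rightarrow> real"
  assumes [measurable]: "g \<in> borel_measurable borel"
    and "\<And>t. t < 0 \<Longrightarrow> g t = 0" "\<And>t. \<bar>g t\<bar> \<le> C0 * exp (- c * t)" "0 < c"
  shows "integrable lborel g"
proof (rule Bochner_Integration.integrable_bound)
  have "has_bochner_integral lborel (\<lambda>t. indicator {0..} t * exp (- c * t)) (exp (- c * 0) / c)"
    using assms by (intro has_bochner_integral_lborel_nonneg has_integral_exp_minus_to_infinity) auto
  then show "integrable lborel (\<lambda>t. C0 * (indicator {0..} t * exp (- c * t)))"
    by (auto simp: has_bochner_integral_iff)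
  show "AE t in lborel. norm (g t) \<le> norm (C0 * (indicator {0..} t * exp (- c * t)))"
  proof (rule AE_I2)
    fix t show "norm (g t) \<le> norm (C0 * (indicator {0..} t * exp (- c * t)))"
      using assms(2)[of t] order_trans[OF assms(3)[of t] abs_ge_self]
      by (cases "t < 0") (auto simp: indicator_def)
  qed
qed measurable

text \<open>The substitution \<open>u = y - t\<close> moves the singularity from
  \<open>t = y\<close> to 0.\<close>

lemma has_bochner_integral_frac_kernel:
  fixes a y d :: real
  assumes "a \<le> y" "0 < d"
  shows "has_bochner_integral lborel (\<lambda>t. indicator {a..y} t * (y - t) powr (d - 1)) ((y - a) powr d / d)"
proof -
  have "has_bochner_integral lborel (\<lambda>u. indicator {0..y - a} u * u powr (d - 1)) ((y - a) powr d / d)"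
    using has_bochner_integral_powr_from_0[of "d - 1" "y - a"] assms by simp
  then have "has_bochner_integral lborel
      (\<lambda>t. indicator {0..y - a} (y + - 1 * t) * (y + - 1 * t) powr (d - 1)) ((y - a) powr d / d)"
    by (subst (asm) lborel_has_bochner_integral_real_affine_iff[of "- 1" _ _ y]) simp_all
  moreover have "indicator {0..y - a} (y + - 1 * t) = (indicator {a..y} t :: real)" for t
    by (auto simp: indicator_def)
  ultimately show ?thesis by simp
qed

subsection \<open>Fractional integral of an exponentially bounded function\<close>

lemma frac_integral_lborel:
  assumes [measurable]: "g \<in> borel_measurable borel"
  shows "frac_integral d g y =
    1 / Gamma d * (\<integral>t. indicator {..y} t * (g t * (y - t) powr (d - 1)) \<partial>lborel)"
  unfolding frac_integral_def set_lebesgue_integral_def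
  by (subst integral_completion) auto

text \<open>The setting for a Borel representative. Borel measurability of \<open>g\<close> makes
  the integrand of \<open>G\<close> jointly measurable in \<open>y\<close> and
  \<open>t\<close>.\<close>

locale exp_bounded_kernel =
  fixes g :: "real \<Rightarrow> real" and d c C0 :: real
  assumes g_measurable [measurable]: "g \<in> borel_measurable borel"
    and g_neg: "\<And>t. t < 0 \<Longrightarrow> g t = 0"
    and g_bound: "\<And>t. \<bar>g t\<bar> \<le> C0 * exp (- c * t)"
    and c_pos: "0 < c" and d_pos: "0 < d" and d_less_1: "d < 1"
begin

lemma C0_nonneg: "0 \<le> C0"
  using order_trans[OF abs_ge_zero g_bound[of 0]] by simp

lemma integrable_g: "integrable lborel g"
  using integrable_exp_bounded[OF g_measurable g_neg g_bound c_pos] .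

text \<open>On the window \<open>\<bar>g\<bar>\<close> is at most its exponential bound at the left
  end \<open>a\<close>, and the kernel integrates to \<open>(y - a) powr d / d\<close>. The case
  \<open>a = 0\<close> controls \<open>G\<close> near 0, the case \<open>a = y / 2\<close> the part
  next to the singularity for large \<open>y\<close>.\<close>

lemma integrable_window:
  assumes "0 \<le> a" "a \<le> y"
  shows "integrable lborel (\<lambda>t. indicator {a..y} t * (g t * (y - t) powr (d - 1)))" (is ?int)
    and "\<bar>\<integral>t. indicator {a..y} t * (g t * (y - t) powr (d - 1)) \<partial>lborel\<bar>
      \<le> C0 * exp (- c * a) * ((y - a) powr d / d)" (is ?bd)
proof -
  let ?w = "\<lambda>t. C0 * exp (- c * a) * (indicator {a..y} t * (y - t) powr (d - 1))"
  have w: "has_bochner_integral lborel ?w (C0 * exp (- c * a) * ((y - a) powr d / d))"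
    using assms d_pos by (intro has_bochner_integral_mult_right has_bochner_integral_frac_kernel) auto
  have le: "norm (indicator {a..y} t * (g t * (y - t) powr (d - 1))) \<le> ?w t" for t
  proof (cases "t \<in> {a..y}")
    case True
    have "\<bar>g t\<bar> \<le> C0 * exp (- c * a)"
      using True c_pos C0_nonneg by (intro order_trans[OF g_bound] mult_left_mono) auto
    then show ?thesis
      using True by (auto simp: abs_mult intro!: mult_right_mono)
  qed auto
  show ?int
  proof (rule Bochner_Integration.integrable_bound)
    show "integrable lborel ?w" using w by (auto simp: has_bochner_integral_iff)
    show "AE t in lborel. norm (indicator {a..y} t * (g t * (y - t) powr (d - 1))) \<le> norm (?w t)"
      using le by (intro AE_I2 order_trans[OF le]) auto
  qed measurable
  show ?bd
    using Bochner_Integration.integral_norm_bound_integral[OF \<open>?int\<close> integrable.intros[OF w] le]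
      has_bochner_integral_integral_eq[OF w] by simp
qed

abbreviation G :: "real \<Rightarrow> real" where "G \<equiv> frac_integral d g"

lemma measurable_G [measurable]: "G \<in> borel_measurable borel"
proof -
  \<comment> \<open>Joint measurability makes \<open>G\<close> a measurable parameter integral; the
    indicator is unfolded to expose the measurable relation \<open>t \<le> y\<close>.\<close>
  have "(\<lambda>(y, t). indicator {..y} t * (g t * (y - t) powr (d - 1))) \<in> borel_measurable (borel \<Otimes>\<^sub>M lborel)"
    unfolding indicator_def by simp
  then show ?thesis
    unfolding frac_integral_lborel[OF g_measurable] by measurable
qed

lemma G_eq:
  "G y = 1 / Gamma d * (\<integral>t. indicator {0..y} t * (g t * (y - t) powr (d - 1)) \<partial>lborel)"
proof -
  have "indicator {..y} t * (g t * (y - t) powr (d - 1)) =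
      indicator {0..y} t * (g t * (y - t) powr (d - 1))" for t
    using g_neg[of t] by (cases "t < 0") (auto simp: indicator_def)
  then show ?thesis by (simp only: frac_integral_lborel[OF g_measurable])
qed

lemma G_neg: "y < 0 \<Longrightarrow> G y = 0"
  by (simp add: G_eq)

lemma Gamma_d_pos: "0 < Gamma d"
  using d_pos by (rule Gamma_real_pos)

text \<open>The window with \<open>a = 0\<close>. Near 0 this bound takes the place of the power
  \<open>y powr (d - 1)\<close>, which blows up there.\<close>

lemma G_le_near_0:
  assumes "0 \<le> y"
  shows "\<bar>G y\<bar> \<le> C0 / (d * Gamma d) * y powr d"
proof -
  have "\<bar>G y\<bar> = \<bar>\<integral>t. indicator {0..y} t * (g t * (y - t) powr (d - 1)) \<partial>lborel\<bar> / Gamma d"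
    using Gamma_d_pos by (simp add: G_eq)
  also have "\<dots> \<le> C0 * exp (- c * 0) * ((y - 0) powr d / d) / Gamma d"
    using assms Gamma_d_pos by (intro divide_right_mono integrable_window) auto
  finally show ?thesis by simp
qed

text \<open>The mass of \<open>g\<close> beyond \<open>y / 2\<close> is exponentially small and absorbs the singularity of the
  kernel at \<open>t = y\<close>; below \<open>y / 2\<close> the rescaled kernel is bounded and tends to 1.\<close>

lemma tendsto_G_scaled:
  "((\<lambda>y. y powr (1 - d) * G y) \<longlongrightarrow> 1 / Gamma d * (\<integral>t. g t \<partial>lborel)) at_top"
proof -
  define k where "k y t = g t * (y - t) powr (d - 1)" for y t
  have k_measurable [measurable]: "k y \<in> borel_measurable borel" for y
    unfolding k_def by measurable
  have head: "((\<lambda>y. \<integral>t. y powr (1 - d) * (indicator {0..<y / 2} t * k y t) \<partial>lborel)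
      \<longlongrightarrow> (\<integral>t. g t \<partial>lborel)) at_top"
  proof (rule integral_dominated_convergence_at_top)
    show "integrable lborel (\<lambda>t. 2 powr (1 - d) * \<bar>g t\<bar>)"
      using integrable_g by auto
    show "AE t in lborel. ((\<lambda>y. y powr (1 - d) * (indicator {0..<y / 2} t * k y t)) \<longlongrightarrow> g t) at_top"
    proof (rule AE_I2)
      fix t :: real
      show "((\<lambda>y. y powr (1 - d) * (indicator {0..<y / 2} t * k y t)) \<longlongrightarrow> g t) at_top"
      proof (cases "t < 0")
        case False
        have "((\<lambda>y. g t * (1 - t / y) powr (d - 1)) \<longlongrightarrow> g t * (1 - 0) powr (d - 1)) at_top"
          by (intro tendsto_intros tendsto_divide_0[OF tendsto_const] filterlim_at_top_imp_at_infinity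
              filterlim_ident) auto
        \<comment> \<open>Once \<open>y > 2 * t\<close> the point \<open>t\<close> lies in the head
          window and its indicator is 1.\<close>
        moreover have "\<forall>\<^sub>F y in at_top. g t * (1 - t / y) powr (d - 1) =
            y powr (1 - d) * (indicator {0..<y / 2} t * k y t)"
          using eventually_gt_at_top[of "2 * t"] eventually_gt_at_top[of 0]
        proof eventually_elim
          case (elim y)
          have "(1 - t / y) powr (d - 1) = ((y - t) / y) powr (d - 1)"
            using elim by (simp add: field_simps)
          also have "\<dots> = (y - t) powr (d - 1) * y powr (1 - d)"
            using elim False powr_minus_divide[of y "1 - d"] by (simp add: powr_divide)
          finally show ?case using elim False by (simp add: k_def)
        qed
        ultimately show ?thesis by (simp add: tendsto_cong)
      qed (simp add: g_neg)
    qed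
    show "\<forall>\<^sub>F y in at_top. AE t in lborel.
        norm (y powr (1 - d) * (indicator {0..<y / 2} t * k y t)) \<le> 2 powr (1 - d) * \<bar>g t\<bar>"
      using eventually_gt_at_top[of 0]
    proof eventually_elim
      case (elim y)
      show ?case
      proof (rule AE_I2)
        fix t :: real
        show "norm (y powr (1 - d) * (indicator {0..<y / 2} t * k y t)) \<le> 2 powr (1 - d) * \<bar>g t\<bar>"
        proof (cases "t \<in> {0..<y / 2}")
          case True
          have "y powr (1 - d) * (y - t) powr (d - 1) \<le> y powr (1 - d) * (y / 2) powr (d - 1)"
            using True elim d_less_1 by (intro mult_left_mono powr_mono2') auto
          also have "\<dots> = 2 powr (1 - d)"
            using elim powr_minus[of y "1 - d"] powr_minus[of 2 "1 - d"]
            by (simp add: powr_divide field_simps)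
          finally have "y powr (1 - d) * (y - t) powr (d - 1) * \<bar>g t\<bar> \<le> 2 powr (1 - d) * \<bar>g t\<bar>"
            by (rule mult_right_mono) simp
          then show ?thesis
            using True by (simp add: k_def abs_mult mult_ac)
        qed simp
      qed
    qed
  qed measurable
  have tail: "((\<lambda>y. y powr (1 - d) * (\<integral>t. indicator {y / 2..y} t * k y t \<partial>lborel)) \<longlongrightarrow> 0) at_top"
  proof (rule Lim_null_comparison)
    show "\<forall>\<^sub>F y in at_top. norm (y powr (1 - d) * (\<integral>t. indicator {y / 2..y} t * k y t \<partial>lborel))
        \<le> C0 / (d * 2 powr d) * (y * exp (- (c / 2) * y))"
      using eventually_gt_at_top[of 0]
    proof eventually_elim
      case (elim y)
      have "norm (y powr (1 - d) * (\<integral>t. indicator {y / 2..y} t * k y t \<partial>lborel))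
          \<le> y powr (1 - d) * (C0 * exp (- c * (y / 2)) * ((y - y / 2) powr d / d))"
        using elim mult_left_mono[OF integrable_window(2)[of "y / 2" y], of "y powr (1 - d)"]
        by (simp add: abs_mult k_def)
      \<comment> \<open>The powers \<open>1 - d\<close> and \<open>d\<close> combine to a single
        factor \<open>y\<close>, which the exponential decay beats.\<close>
      also have "\<dots> = C0 / (d * 2 powr d) * (y * exp (- (c / 2) * y))"
        using elim by (simp add: powr_divide powr_diff field_simps)
      finally show ?case .
    qed
    have "((\<lambda>y. y * exp (- (c / 2) * y)) \<longlongrightarrow> 0) at_top"
      using c_pos by real_asymp
    then show "((\<lambda>y. C0 / (d * 2 powr d) * (y * exp (- (c / 2) * y))) \<longlongrightarrow> 0) at_top"
      by (rule tendsto_mult_right_zero)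
  qed
  have "\<forall>\<^sub>F y in at_top. 1 / Gamma d * ((\<integral>t. y powr (1 - d) * (indicator {0..<y / 2} t * k y t) \<partial>lborel)
      + y powr (1 - d) * (\<integral>t. indicator {y / 2..y} t * k y t \<partial>lborel)) = y powr (1 - d) * G y"
    using eventually_gt_at_top[of 0]
  proof eventually_elim
    case (elim y)
    have int: "integrable lborel (\<lambda>t. indicator {y / 2..y} t * k y t)"
      "integrable lborel (\<lambda>t. indicator {0..y} t * k y t)"
      using elim integrable_window(1) by (auto simp: k_def)
    have split: "indicator {0..y} t * k y t - indicator {y / 2..y} t * k y t =
        indicator {0..<y / 2} t * k y t" for t
      using elim by (auto simp: indicator_def)
    have "(\<integral>t. indicator {0..<y / 2} t * k y t \<partial>lborel)
        = (\<integral>t. indicator {0..y} t * k y t \<partial>lborel) - (\<integral>t. indicator {y / 2..y} t * k y t \<partial>lborel)"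
      using int by (simp flip: split)
    moreover have "G y = 1 / Gamma d * (\<integral>t. indicator {0..y} t * k y t \<partial>lborel)"
      by (simp add: G_eq k_def)
    ultimately show ?case
      by (simp only: integral_mult_right_zero) (simp only: algebra_simps)
  qed
  moreover have "((\<lambda>y. 1 / Gamma d * ((\<integral>t. y powr (1 - d) * (indicator {0..<y / 2} t * k y t) \<partial>lborel)
      + y powr (1 - d) * (\<integral>t. indicator {y / 2..y} t * k y t \<partial>lborel)))
      \<longlongrightarrow> 1 / Gamma d * ((\<integral>t. g t \<partial>lborel) + 0)) at_top"
    by (intro tendsto_mult_left tendsto_add head tail)
  ultimately show ?thesis by (simp add: tendsto_cong)
qed

text \<open>Beyond some \<open>b\<close> the rescaled \<open>G\<close> is within 1 of its limit;
  below \<open>b\<close> the bound by \<open>y powr d\<close> becomes linear in \<open>y\<close>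
  after rescaling, hence at most a multiple of \<open>\<bar>b\<bar>\<close>.\<close>

lemma G_le_power:
  obtains M where "0 < M" "\<And>y. 0 < y \<Longrightarrow> \<bar>G y\<bar> \<le> M * y powr (d - 1)"
proof -
  obtain b where b: "\<And>y. y \<ge> b \<Longrightarrow> \<bar>y powr (1 - d) * G y - 1 / Gamma d * (\<integral>t. g t \<partial>lborel)\<bar> < 1"
    using tendstoD[OF tendsto_G_scaled, of 1] by (auto simp: eventually_at_top_linorder dist_real_def)
  \<comment> \<open>The summand 1 is the tolerance in the choice of \<open>b\<close> and also makes
    \<open>M\<close> positive.\<close>
  define M where "M = \<bar>1 / Gamma d * (\<integral>t. g t \<partial>lborel)\<bar> + 1 + C0 / (d * Gamma d) * \<bar>b\<bar>"
  have K: "0 \<le> C0 / (d * Gamma d)"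
    using C0_nonneg d_pos Gamma_d_pos by simp
  have scaled: "y powr (1 - d) * \<bar>G y\<bar> \<le> M" if "0 < y" for y
  proof (cases "b \<le> y")
    case True
    have "y powr (1 - d) * \<bar>G y\<bar> = \<bar>y powr (1 - d) * G y\<bar>"
      by (simp add: abs_mult)
    also have "\<dots> \<le> \<bar>1 / Gamma d * (\<integral>t. g t \<partial>lborel)\<bar> + 1"
      using b[OF True] by linarith
    also have "\<dots> \<le> M"
      using mult_nonneg_nonneg[OF K abs_ge_zero[of b]] unfolding M_def by linarith
    finally show ?thesis .
  next
    case False
    have "y powr (1 - d) * \<bar>G y\<bar> \<le> y powr (1 - d) * (C0 / (d * Gamma d) * y powr d)"
      using that by (intro mult_left_mono G_le_near_0) auto
    also have "\<dots> = C0 / (d * Gamma d) * y"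
      using that by (simp flip: powr_add add: mult.left_commute)
    also have "\<dots> \<le> C0 / (d * Gamma d) * \<bar>b\<bar>"
      using K False by (intro mult_left_mono) auto
    also have "\<dots> \<le> M" by (simp add: M_def)
    finally show ?thesis .
  qed
  show ?thesis
  proof (rule that)
    show "0 < M"
      using mult_nonneg_nonneg[OF K abs_ge_zero[of b]] unfolding M_def by linarith
    fix y :: real assume y: "0 < y"
    then have "\<bar>G y\<bar> = y powr (1 - d) * \<bar>G y\<bar> * y powr (d - 1)"
      by (simp add: mult.assoc mult.left_commute flip: powr_add)
    also have "\<dots> \<le> M * y powr (d - 1)"
      using scaled[OF y] by (intro mult_right_mono) auto
    finally show "\<bar>G y\<bar> \<le> M * y powr (d - 1)" .
  qed
qed

section \<open>Integrability of the kernel and scaling limit of the defect integral\<close>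

lemma integrable_G_powr:
  assumes "0 < \<alpha>" "1 < \<alpha> * (1 - d)"
  shows "integrable lborel (\<lambda>y. \<bar>G y\<bar> powr \<alpha>)"
proof -
  obtain M where M: "0 < M" "\<And>y. 0 < y \<Longrightarrow> \<bar>G y\<bar> \<le> M * y powr (d - 1)"
    using G_le_power by blast
  let ?K = "C0 / (d * Gamma d)"
  \<comment> \<open>Two regimes: \<open>G\<close> is bounded on [0, 1], and beyond 1 its power bound
    is integrable because \<open>\<alpha> * (1 - d) > 1\<close>.\<close>
  let ?w = "\<lambda>y. ?K powr \<alpha> * indicator {0..1} y +
    M powr \<alpha> * (indicator {1..} y * y powr ((d - 1) * \<alpha>)) :: real"
  show ?thesis
  proof (rule Bochner_Integration.integrable_bound)
    have "integrable lborel (\<lambda>y. indicator {1..} y * y powr ((d - 1) * \<alpha>))"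
      using assms by (intro integrable_powr_to_inf) (auto simp: algebra_simps)
    then show "integrable lborel ?w" by auto
    show "AE y in lborel. norm (\<bar>G y\<bar> powr \<alpha>) \<le> norm (?w y)"
    proof (rule AE_I2)
      fix y :: real
      consider "y < 0" | "0 \<le> y" "y \<le> 1" | "1 < y" by linarith
      then show "norm (\<bar>G y\<bar> powr \<alpha>) \<le> norm (?w y)"
      proof cases
        case 1
        then show ?thesis by (simp add: G_neg)
      next
        case 2
        have "\<bar>G y\<bar> \<le> ?K * y powr d" using G_le_near_0 2 by simp
        also have "\<dots> \<le> ?K * 1"
          using 2 d_pos C0_nonneg Gamma_d_pos by (intro mult_left_mono powr_le1) auto
        finally have "\<bar>G y\<bar> powr \<alpha> \<le> ?K powr \<alpha>"
          using assms by (intro powr_mono2) auto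
        then show ?thesis using 2 by (simp add: add_increasing2)
      next
        case 3
        have "\<bar>G y\<bar> powr \<alpha> \<le> (M * y powr (d - 1)) powr \<alpha>"
          using 3 M assms by (intro powr_mono2) auto
        then show ?thesis using 3 M by (simp add: powr_mult powr_powr)
      qed
    qed
  qed measurable
qed

text \<open>With \<open>x = - T * z\<close> the arguments of \<open>G\<close> become
  \<open>T * (z - 1)\<close> and \<open>T * z\<close>, and the prefactor becomes
  \<open>(T powr (1 - d)) powr \<alpha>\<close>, which homogeneity moves inside the defect. The
  majorant \<open>?w\<close> comes from \<open>G_le_power\<close> and
  \<open>abs_codiff_le\<close>.\<close>

lemma tendsto_codiff_integral:
  assumes \<alpha>: "1 < \<alpha>" "\<alpha> < 2" "1 < \<alpha> * (1 - d)"
  shows "((\<lambda>T. T powr (\<alpha> * (1 - d) - 1) * (\<integral>x. codiff \<alpha> (\<theta>\<^sub>1 * G (- T - x)) (\<theta>\<^sub>2 * G (- x)) \<partial>lborel))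
    \<longlongrightarrow> \<bar>1 / Gamma d * (\<integral>t. g t \<partial>lborel)\<bar> powr \<alpha> *
      (\<integral>x. indicator {1..} x * codiff \<alpha> (\<theta>\<^sub>1 * (x - 1) powr (d - 1)) (\<theta>\<^sub>2 * x powr (d - 1)) \<partial>lborel)) at_top"
    (is "(?L \<longlongrightarrow> \<bar>?m\<bar> powr \<alpha> * _) _")
proof -
  obtain M where M: "0 < M" and M_bound: "\<And>y. 0 < y \<Longrightarrow> \<bar>G y\<bar> \<le> M * y powr (d - 1)"
    using G_le_power by blast
  let ?g = "\<lambda>T z. T powr (1 - d) * G (T * z)"
  let ?s = "\<lambda>T z. codiff \<alpha> (\<theta>\<^sub>1 * ?g T (z - 1)) (\<theta>\<^sub>2 * ?g T z)"
  let ?f = "\<lambda>z. indicator {1..} z * codiff \<alpha> (?m * (\<theta>\<^sub>1 * (z - 1) powr (d - 1))) (?m * (\<theta>\<^sub>2 * z powr (d - 1)))"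
  let ?K = "\<alpha> * 2 powr (\<alpha> - 1) + 1"
  let ?w = "\<lambda>z. ?K * (\<bar>\<theta>\<^sub>1 * M\<bar> powr (\<alpha> - 1) * \<bar>\<theta>\<^sub>2 * M\<bar> *
        (indicator {1<..} z * ((z - 1) powr - ((1 - d) * (\<alpha> - 1)) * z powr - (1 - d)))
      + \<bar>\<theta>\<^sub>2 * M\<bar> powr \<alpha> * (indicator {1..} z * z powr ((d - 1) * \<alpha>)))"
  \<comment> \<open>\<open>?g T z\<close> is \<open>z powr (d - 1)\<close> times the rescaled
    \<open>G\<close> at \<open>T * z\<close>, which tends to infinity with \<open>T\<close>.\<close>
  have pointwise: "((\<lambda>T. ?g T z) \<longlongrightarrow> ?m * z powr (d - 1)) at_top" if "0 < z" for z
  proof -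
    have "filterlim (\<lambda>T. T * z) at_top at_top"
      using that by (intro filterlim_at_top_mult_tendsto_pos[OF tendsto_const] filterlim_ident)
    then have "((\<lambda>T. z powr (d - 1) * ((T * z) powr (1 - d) * G (T * z))) \<longlongrightarrow> z powr (d - 1) * ?m) at_top"
      by (intro tendsto_mult_left filterlim_compose[OF tendsto_G_scaled])
    moreover have "\<forall>\<^sub>F T in at_top. z powr (d - 1) * ((T * z) powr (1 - d) * G (T * z)) = ?g T z"
      using eventually_gt_at_top[of 0]
      by eventually_elim (use that powr_minus_divide[of z "1 - d"] in \<open>simp add: powr_mult\<close>)
    ultimately show ?thesis
      using Lim_transform_eventually by (subst mult.commute)
  qed
  have dominated: "\<bar>?g T z\<bar> \<le> M * z powr (d - 1)" if "0 < z" "0 < T" for T z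
  proof -
    have "\<bar>?g T z\<bar> \<le> T powr (1 - d) * (M * (T * z) powr (d - 1))"
      using M_bound[of "T * z"] that by (simp add: abs_mult mult_left_mono)
    also have "\<dots> = M * z powr (d - 1)"
      using that powr_minus_divide[of T "1 - d"] by (simp add: powr_mult)
    finally show ?thesis .
  qed
  have "((\<lambda>T. \<integral>z. ?s T z \<partial>lborel) \<longlongrightarrow> (\<integral>z. ?f z \<partial>lborel)) at_top"
  proof (rule integral_dominated_convergence_at_top)
    \<comment> \<open>The singularity of the majorant at \<open>z = 1\<close> has order
      \<open>(1 - d) * (\<alpha> - 1) < 1\<close>, while its decay at infinity has order
      \<open>\<alpha> * (1 - d) > 1\<close>.\<close>
    have "(1 - d) * (\<alpha> - 1) < 1 * 1"
      using \<alpha> d_pos d_less_1 by (intro mult_strict_mono) auto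
    moreover have "0 \<le> (1 - d) * (\<alpha> - 1)"
      using \<alpha> d_less_1 by simp
    ultimately have "integrable lborel (\<lambda>z. indicator {1<..} z *
        ((z - 1) powr - ((1 - d) * (\<alpha> - 1)) * z powr - (1 - d)))"
      using \<alpha> d_less_1 by (intro integrable_shifted_powr_mult) (simp_all add: algebra_simps)
    moreover have "integrable lborel (\<lambda>z. indicator {1..} z * z powr ((d - 1) * \<alpha>))"
      using \<alpha> by (intro integrable_powr_to_inf) (auto simp: algebra_simps)
    ultimately show "integrable lborel ?w"
      by (intro integrable_mult_right Bochner_Integration.integrable_add)
    show "AE z in lborel. ((\<lambda>T. ?s T z) \<longlongrightarrow> ?f z) at_top"
      \<comment> \<open>The null point \<open>z = 1\<close> is left out because
        \<open>pointwise\<close> asks for \<open>z - 1 > 0\<close>.\<close>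
      using AE_lborel_singleton[of 1]
    proof eventually_elim
      case (elim z)
      show ?case
      proof (cases "z < 1")
        case True
        \<comment> \<open>Left of 1 the argument \<open>T * (z - 1)\<close> is negative, so
          \<open>G\<close> and with it the defect vanish.\<close>
        have "\<forall>\<^sub>F T in at_top. ?f z = ?s T z"
          using eventually_gt_at_top[of 0]
          by eventually_elim (use True in \<open>simp add: G_neg mult_pos_neg\<close>)
        then show ?thesis using tendsto_cong by force
      next
        case False
        then have "((\<lambda>T. ?s T z) \<longlongrightarrow>
            codiff \<alpha> (\<theta>\<^sub>1 * (?m * (z - 1) powr (d - 1))) (\<theta>\<^sub>2 * (?m * z powr (d - 1)))) at_top"
          using elim \<alpha> by (intro tendsto_codiff tendsto_mult_left pointwise) auto
        then show ?thesis using False by (simp add: mult.left_commute)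
      qed
    qed
    show "\<forall>\<^sub>F T in at_top. AE z in lborel. norm (?s T z) \<le> ?w z"
      using eventually_gt_at_top[of 0]
    proof eventually_elim
      case (elim T)
      show ?case
        using AE_lborel_singleton[of 1]
      proof eventually_elim
        case (elim z)
        show ?case
        proof (cases "z < 1")
          case True
          then show ?thesis using \<open>0 < T\<close> by (simp add: G_neg mult_pos_neg)
        next
          case False
          then have z: "1 < z" using elim by simp
          have a: "\<bar>\<theta>\<^sub>1 * ?g T (z - 1)\<bar> \<le> \<bar>\<theta>\<^sub>1 * M\<bar> * (z - 1) powr (d - 1)"
            using dominated[of "z - 1" T] \<open>0 < T\<close> z M
            by (simp add: abs_mult[of \<theta>\<^sub>1] mult.assoc mult_left_mono)
          have b: "\<bar>\<theta>\<^sub>2 * ?g T z\<bar> \<le> \<bar>\<theta>\<^sub>2 * M\<bar> * z powr (d - 1)"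
            using dominated[of z T] \<open>0 < T\<close> z M
            by (simp add: abs_mult[of \<theta>\<^sub>2] mult.assoc mult_left_mono)
          have "norm (?s T z) \<le> ?K * (\<bar>\<theta>\<^sub>1 * ?g T (z - 1)\<bar> powr (\<alpha> - 1) * \<bar>\<theta>\<^sub>2 * ?g T z\<bar>
              + \<bar>\<theta>\<^sub>2 * ?g T z\<bar> powr \<alpha>)"
            using abs_codiff_le[of \<alpha>] \<alpha> by simp
          also have "\<dots> \<le> ?K * ((\<bar>\<theta>\<^sub>1 * M\<bar> * (z - 1) powr (d - 1)) powr (\<alpha> - 1) *
              (\<bar>\<theta>\<^sub>2 * M\<bar> * z powr (d - 1)) + (\<bar>\<theta>\<^sub>2 * M\<bar> * z powr (d - 1)) powr \<alpha>)"
            using a b \<alpha> by (intro mult_left_mono add_mono mult_mono powr_mono2) auto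
          also have "\<dots> = ?w z"
            using z by (simp add: powr_mult powr_powr algebra_simps)
          finally show ?thesis .
        qed
      qed
    qed
  qed measurable
  also have "(\<integral>z. ?f z \<partial>lborel) = \<bar>?m\<bar> powr \<alpha> *
      (\<integral>x. indicator {1..} x * codiff \<alpha> (\<theta>\<^sub>1 * (x - 1) powr (d - 1)) (\<theta>\<^sub>2 * x powr (d - 1)) \<partial>lborel)"
    unfolding codiff_mult integral_mult_right_zero[symmetric]
    by (intro Bochner_Integration.integral_cong) simp_all
  finally have lim: "((\<lambda>T. \<integral>z. ?s T z \<partial>lborel) \<longlongrightarrow> \<dots>) at_top" .
  have "\<forall>\<^sub>F T in at_top. ?L T = (\<integral>z. ?s T z \<partial>lborel)"
    using eventually_gt_at_top[of 0]
  proof eventually_elim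
    case (elim T)
    have "?L T = T powr (\<alpha> * (1 - d) - 1) *
        (T * (\<integral>z. codiff \<alpha> (\<theta>\<^sub>1 * G (T * (z - 1))) (\<theta>\<^sub>2 * G (T * z)) \<partial>lborel))"
      using elim by (subst lborel_integral_real_affine[of "- T" _ 0]) (simp_all add: algebra_simps)
    also have "\<dots> = (T powr (1 - d)) powr \<alpha> *
        (\<integral>z. codiff \<alpha> (\<theta>\<^sub>1 * G (T * (z - 1))) (\<theta>\<^sub>2 * G (T * z)) \<partial>lborel)"
      unfolding mult.assoc[symmetric]
      using elim powr_add[of T "\<alpha> * (1 - d) - 1" 1] by (simp add: powr_powr mult.commute)
    also have "\<dots> = (\<integral>z. codiff \<alpha> (T powr (1 - d) * (\<theta>\<^sub>1 * G (T * (z - 1))))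
        (T powr (1 - d) * (\<theta>\<^sub>2 * G (T * z))) \<partial>lborel)"
      unfolding codiff_mult by simp
    finally show ?case by (simp only: mult.left_commute)
  qed
  then show ?thesis using lim by (simp only: tendsto_cong)
qed

end

subsection \<open>Characteristic functions and the dependence measure\<close>

text \<open>The quotient \<open>(exp y - 1) / y\<close>, continued by 1 at 0, is continuous there;
  the continuation lets \<open>u\<close> take the value 0.\<close>

lemma tendsto_mult_exp_minus_1:
  fixes u w :: "'a \<Rightarrow> real"
  assumes u: "(u \<longlongrightarrow> 0) F" and wu: "((\<lambda>x. w x * u x) \<longlongrightarrow> l) F"
  shows "((\<lambda>x. w x * (exp (u x) - 1)) \<longlongrightarrow> l) F"
proof -
  define q where "q y = (if y = 0 then 1 else (exp y - 1) / y)" for y :: real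
  have "isCont q 0"
    unfolding isCont_def q_def
    using lim_exp_minus_1[where 'a = real] by (auto cong: Lim_cong_within)
  then have "((\<lambda>x. q (u x)) \<longlongrightarrow> q 0) F"
    using u by (rule isCont_tendsto_compose)
  from tendsto_mult[OF wu this] have "((\<lambda>x. w x * u x * q (u x)) \<longlongrightarrow> l) F"
    by (simp add: q_def)
  moreover have "w x * u x * q (u x) = w x * (exp (u x) - 1)" for x
    by (simp add: q_def)
  ultimately show ?thesis by simp
qed

lemma Lp_real_linear:
  assumes "f \<in> Lp_real p" "h \<in> Lp_real p" "0 \<le> p"
  shows "(\<lambda>x. a * f x + b * h x) \<in> Lp_real p"
proof -
  have [measurable]: "f \<in> borel_measurable lebesgue" "h \<in> borel_measurable lebesgue"
    and int: "integrable lebesgue (\<lambda>x. \<bar>f x\<bar> powr p)" "integrable lebesgue (\<lambda>x. \<bar>h x\<bar> powr p)"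
    using assms by (auto simp: Lp_real_def)
  have "integrable lebesgue (\<lambda>x. \<bar>a * f x + b * h x\<bar> powr p)"
  proof (rule Bochner_Integration.integrable_bound)
    show "integrable lebesgue (\<lambda>x. 2 powr p * (\<bar>a\<bar> powr p * \<bar>f x\<bar> powr p + \<bar>b\<bar> powr p * \<bar>h x\<bar> powr p))"
      using int by (intro integrable_mult_right Bochner_Integration.integrable_add)
    show "AE x in lebesgue. norm (\<bar>a * f x + b * h x\<bar> powr p) \<le>
        norm (2 powr p * (\<bar>a\<bar> powr p * \<bar>f x\<bar> powr p + \<bar>b\<bar> powr p * \<bar>h x\<bar> powr p))"
    proof (rule AE_I2)
      fix x
      have "\<bar>a * f x + b * h x\<bar> powr p \<le> (\<bar>a * f x\<bar> + \<bar>b * h x\<bar>) powr p"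
        using assms by (intro powr_mono2) auto
      also have "\<dots> \<le> 2 powr p * (\<bar>a * f x\<bar> powr p + \<bar>b * h x\<bar> powr p)"
        using assms by (intro powr_add_le) auto
      finally show "norm (\<bar>a * f x + b * h x\<bar> powr p) \<le>
          norm (2 powr p * (\<bar>a\<bar> powr p * \<bar>f x\<bar> powr p + \<bar>b\<bar> powr p * \<bar>h x\<bar> powr p))"
        by (simp add: abs_mult powr_mult)
    qed
  qed measurable
  then show ?thesis by (simp add: Lp_real_def)
qed

lemma stable_integral_char_single:
  assumes "stable_integral M \<alpha> L J" "f \<in> Lp_real \<alpha>"
  shows "(CLINT \<omega>|M. iexp (\<theta> * J f \<omega>)) =
    complex_of_real (exp (- (\<bar>\<theta>\<bar> powr \<alpha> * (LINT x|lebesgue. \<bar>f x\<bar> powr \<alpha>))))"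
  using assms by (simp add: stable_integral_def)

text \<open>Almost sure linearity makes the combination a single stable integral, whose
  characteristic function is read off at 1.\<close>

lemma stable_integral_char_pair:
  assumes J: "stable_integral M \<alpha> L J" and f: "f \<in> Lp_real \<alpha>" and h: "h \<in> Lp_real \<alpha>" and "0 \<le> \<alpha>"
  shows "(CLINT \<omega>|M. iexp (\<theta>\<^sub>1 * J f \<omega> + \<theta>\<^sub>2 * J h \<omega>)) =
    complex_of_real (exp (- (LINT x|lebesgue. \<bar>\<theta>\<^sub>1 * f x + \<theta>\<^sub>2 * h x\<bar> powr \<alpha>)))"
proof -
  let ?k = "\<lambda>x. \<theta>\<^sub>1 * f x + \<theta>\<^sub>2 * h x"
  have k: "?k \<in> Lp_real \<alpha>"
    using assms by (intro Lp_real_linear)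
  have [measurable]: "J f \<in> borel_measurable M" "J h \<in> borel_measurable M" "J ?k \<in> borel_measurable M"
    using J f h k by (simp_all add: stable_integral_def)
  have "AE \<omega> in M. J ?k \<omega> = \<theta>\<^sub>1 * J f \<omega> + \<theta>\<^sub>2 * J h \<omega>"
    using J f h by (simp add: stable_integral_def)
  then have "AE \<omega> in M. iexp (\<theta>\<^sub>1 * J f \<omega> + \<theta>\<^sub>2 * J h \<omega>) = iexp (1 * J ?k \<omega>)"
    by eventually_elim simp
  then have "(CLINT \<omega>|M. iexp (\<theta>\<^sub>1 * J f \<omega> + \<theta>\<^sub>2 * J h \<omega>)) = (CLINT \<omega>|M. iexp (1 * J ?k \<omega>))"
    by (intro integral_cong_AE) measurable
  also have "\<dots> = complex_of_real (exp (- (LINT x|lebesgue. \<bar>?k x\<bar> powr \<alpha>)))"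
    using stable_integral_char_single[OF J k, of 1] by simp
  finally show ?thesis .
qed

section \<open>The dependence measure of the moving average\<close>

context exp_bounded_kernel
begin

lemma fima_process_eq: "fima_process J d g t = J (\<lambda>x. G (t - x))"
proof -
  have "indicator {..t} x * G (t - x) = G (t - x)" for x
    using G_neg[of "t - x"] by (cases "x \<le> t") auto
  then show ?thesis by (simp only: fima_process_def)
qed

lemma integrable_G_shift:
  assumes "0 < \<alpha>" "1 < \<alpha> * (1 - d)"
  shows "integrable lborel (\<lambda>x. \<bar>G (t - x)\<bar> powr \<alpha>)"
  using lborel_integrable_real_affine[OF integrable_G_powr[OF assms], of "- 1" t] by simp

text \<open>Stationarity of the marginals: their exponent is the same at every time.\<close>

lemma integral_G_shift: "(\<integral>x. \<bar>G (t - x)\<bar> powr \<alpha> \<partial>lborel) = (\<integral>x. \<bar>G x\<bar> powr \<alpha> \<partial>lborel)"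
  by (subst lborel_integral_real_affine[of "- 1" "\<lambda>x. \<bar>G x\<bar> powr \<alpha>" t]) simp_all

lemma G_shift_Lp:
  assumes "0 < \<alpha>" "1 < \<alpha> * (1 - d)"
  shows "(\<lambda>x. G (t - x)) \<in> Lp_real \<alpha>"
  unfolding Lp_real_def
  using integrable_G_shift[OF assms, of t]
  by (auto simp: integrable_completion intro!: measurable_completion)

text \<open>The joint exponent is the sum of the marginal exponents and the defect integral, so the
  product of the marginal characteristic functions factors out. The splitting rests on the
  finiteness of the three integrals.\<close>

lemma dependence_r_eq:
  assumes J: "stable_integral M \<alpha> L J" and \<alpha>: "1 < \<alpha>" "1 < \<alpha> * (1 - d)"
  shows "dependence_r M (fima_process J d g) \<theta>\<^sub>1 \<theta>\<^sub>2 t = complex_of_real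
    (exp (- ((\<bar>\<theta>\<^sub>1\<bar> powr \<alpha> + \<bar>\<theta>\<^sub>2\<bar> powr \<alpha>) * (\<integral>x. \<bar>G x\<bar> powr \<alpha> \<partial>lborel))) *
      (exp (- (\<integral>x. codiff \<alpha> (\<theta>\<^sub>1 * G (t - x)) (\<theta>\<^sub>2 * G (- x)) \<partial>lborel)) - 1))"
proof -
  let ?N = "\<integral>x. \<bar>G x\<bar> powr \<alpha> \<partial>lborel"
  \<comment> \<open>Writing \<open>0 - x\<close> keeps the kernel in the form \<open>t - x\<close>
    at \<open>t = 0\<close>.\<close>
  let ?D = "\<integral>x. \<bar>\<theta>\<^sub>1 * G (t - x) + \<theta>\<^sub>2 * G (0 - x)\<bar> powr \<alpha> \<partial>lborel"
  have shift: "integrable lborel (\<lambda>x. \<bar>G (s - x)\<bar> powr \<alpha>)" for s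
    using \<alpha> by (intro integrable_G_shift) auto
  have Lp: "(\<lambda>x. G (s - x)) \<in> Lp_real \<alpha>" for s
    using \<alpha> by (intro G_shift_Lp) auto
  have pair: "(\<lambda>x. \<theta>\<^sub>1 * G (t - x) + \<theta>\<^sub>2 * G (0 - x)) \<in> Lp_real \<alpha>"
    using \<alpha> by (intro Lp_real_linear Lp) auto
  then have int: "integrable lborel (\<lambda>x. \<bar>\<theta>\<^sub>1 * G (t - x) + \<theta>\<^sub>2 * G (0 - x)\<bar> powr \<alpha>)"
    by (simp add: Lp_real_def integrable_completion)
  have joint: "(CLINT \<omega>|M. iexp (\<theta>\<^sub>1 * J (\<lambda>x. G (t - x)) \<omega> + \<theta>\<^sub>2 * J (\<lambda>x. G (0 - x)) \<omega>)) =
      complex_of_real (exp (- ?D))"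
    using \<alpha> by (subst stable_integral_char_pair[OF J Lp Lp]) (auto simp: integral_completion)
  have single: "(CLINT \<omega>|M. iexp (\<theta> * J (\<lambda>x. G (s - x)) \<omega>)) =
      complex_of_real (exp (- (\<bar>\<theta>\<bar> powr \<alpha> * ?N)))" for \<theta> s
    by (subst stable_integral_char_single[OF J Lp]) (simp add: integral_completion integral_G_shift)
  have "(\<integral>x. codiff \<alpha> (\<theta>\<^sub>1 * G (t - x)) (\<theta>\<^sub>2 * G (0 - x)) \<partial>lborel) =
      (\<integral>x. \<bar>\<theta>\<^sub>1 * G (t - x) + \<theta>\<^sub>2 * G (0 - x)\<bar> powr \<alpha> - \<bar>\<theta>\<^sub>1\<bar> powr \<alpha> * \<bar>G (t - x)\<bar> powr \<alpha>
        - \<bar>\<theta>\<^sub>2\<bar> powr \<alpha> * \<bar>G (0 - x)\<bar> powr \<alpha> \<partial>lborel)"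
    by (simp add: codiff_def abs_mult powr_mult)
  also have "\<dots> = ?D - \<bar>\<theta>\<^sub>1\<bar> powr \<alpha> * (\<integral>x. \<bar>G (t - x)\<bar> powr \<alpha> \<partial>lborel)
        - \<bar>\<theta>\<^sub>2\<bar> powr \<alpha> * (\<integral>x. \<bar>G (0 - x)\<bar> powr \<alpha> \<partial>lborel)"
    using int shift[of t] shift[of 0] by simp
  also have "\<dots> = ?D - (\<bar>\<theta>\<^sub>1\<bar> powr \<alpha> + \<bar>\<theta>\<^sub>2\<bar> powr \<alpha>) * ?N"
    by (simp only: integral_G_shift) (simp add: algebra_simps)
  finally have D: "?D = (\<bar>\<theta>\<^sub>1\<bar> powr \<alpha> + \<bar>\<theta>\<^sub>2\<bar> powr \<alpha>) * ?N
      + (\<integral>x. codiff \<alpha> (\<theta>\<^sub>1 * G (t - x)) (\<theta>\<^sub>2 * G (0 - x)) \<partial>lborel)"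
    by simp
  have exp_eq: "exp (- ((a + b) * N + i)) - exp (- (a * N)) * exp (- (b * N)) =
      exp (- ((a + b) * N)) * (exp (- i) - 1)" for a b N i :: real
    by (simp add: right_diff_distrib distrib_right flip: exp_add)
  show ?thesis
    unfolding dependence_r_def fima_process_eq joint single D of_real_mult[symmetric] of_real_diff[symmetric]
      exp_eq by simp
qed

lemma tendsto_dependence_r:
  assumes J: "stable_integral M \<alpha> L J" and \<alpha>: "1 < \<alpha>" "\<alpha> < 2" "1 < \<alpha> * (1 - d)"
  shows "((\<lambda>t. complex_of_real (\<bar>t\<bar> powr (\<alpha> * (1 - d) - 1)) *
      dependence_r M (fima_process J d g) \<theta>\<^sub>1 \<theta>\<^sub>2 t) \<longlongrightarrow>
    complex_of_real (- (exp (- ((\<bar>\<theta>\<^sub>1\<bar> powr \<alpha> + \<bar>\<theta>\<^sub>2\<bar> powr \<alpha>) * (\<integral>x. \<bar>G x\<bar> powr \<alpha> \<partial>lborel))) *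
      (\<bar>1 / Gamma d * (\<integral>t. g t \<partial>lborel)\<bar> powr \<alpha> *
      (\<integral>x. indicator {1..} x * codiff \<alpha> (\<theta>\<^sub>1 * (x - 1) powr (d - 1)) (\<theta>\<^sub>2 * x powr (d - 1)) \<partial>lborel))))) at_bot"
    (is "(_ \<longlongrightarrow> complex_of_real (- (?K * ?C))) _")
proof -
  let ?I = "\<lambda>T. \<integral>x. codiff \<alpha> (\<theta>\<^sub>1 * G (- T - x)) (\<theta>\<^sub>2 * G (- x)) \<partial>lborel"
  let ?p = "\<alpha> * (1 - d) - 1"
  have I: "((\<lambda>T. T powr ?p * ?I T) \<longlongrightarrow> ?C) at_top"
    by (rule tendsto_codiff_integral[OF \<alpha>])
  \<comment> \<open>Since \<open>?p\<close> is positive, dividing the convergent product by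
    \<open>T powr ?p\<close> forces \<open>?I\<close> to 0.\<close>
  have "((\<lambda>T. T powr - ?p * (T powr ?p * ?I T)) \<longlongrightarrow> 0 * ?C) at_top"
    using \<alpha> by (intro tendsto_mult I tendsto_neg_powr filterlim_ident) auto
  moreover have "\<forall>\<^sub>F T in at_top. T powr - ?p * (T powr ?p * ?I T) = ?I T"
    using eventually_gt_at_top[of 0]
    by eventually_elim (simp flip: mult.assoc powr_add)
  ultimately have "(?I \<longlongrightarrow> 0 * ?C) at_top"
    by (rule Lim_transform_eventually)
  then have "(?I \<longlongrightarrow> 0) at_top"
    by simp
  then have "((\<lambda>T. T powr ?p * (exp (- ?I T) - 1)) \<longlongrightarrow> - ?C) at_top"
    using tendsto_minus[OF I] by (intro tendsto_mult_exp_minus_1) (auto intro: tendsto_eq_intros)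
  then have "((\<lambda>T. complex_of_real (?K * (T powr ?p * (exp (- ?I T) - 1)))) \<longlongrightarrow>
      complex_of_real (?K * - ?C)) at_top"
    by (intro tendsto_of_real tendsto_mult_left)
  moreover have "\<forall>\<^sub>F T in at_top. complex_of_real (?K * (T powr ?p * (exp (- ?I T) - 1))) =
      complex_of_real (\<bar>- T\<bar> powr ?p) * dependence_r M (fima_process J d g) \<theta>\<^sub>1 \<theta>\<^sub>2 (- T)"
    using eventually_gt_at_top[of 0]
    by eventually_elim (simp add: dependence_r_eq[OF J \<alpha>(1,3)] mult.left_commute)
  ultimately show ?thesis
    unfolding filterlim_at_bot_mirror by (simp add: tendsto_cong)
qed

end

subsection \<open>Passage to a Borel representative\<close>

text \<open>Changing \<open>f\<close> on a null set leaves the integral alone; once the integrand is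
  Borel, the completed measure and \<open>lborel\<close> give the same value.\<close>

lemma set_integral_lebesgue_cong:
  fixes f h :: "real \<Rightarrow> real"
  assumes [measurable]: "f \<in> borel_measurable lebesgue" "h \<in> borel_measurable borel"
      "k \<in> borel_measurable borel" "A \<in> sets borel"
    and "AE x in lborel. f x = h x"
  shows "(LINT x:A|lebesgue. f x * k x) = (\<integral>x. indicator A x * (h x * k x) \<partial>lborel)"
proof -
  have [measurable]: "h \<in> borel_measurable lebesgue" "k \<in> borel_measurable lebesgue"
    using assms by (auto intro!: measurable_completion)
  have [measurable]: "A \<in> sets lebesgue"
    using assms by simp
  have "(LINT x:A|lebesgue. f x * k x) = (LINT x|lebesgue. indicator A x * (h x * k x))"
    unfolding set_lebesgue_integral_def
    using AE_completion[OF assms(5)] assms(4) by (intro integral_cong_AE) auto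
  then show ?thesis by (simp add: integral_completion)
qed

text \<open>Reflection preserves null sets. The detour through a Borel null set \<open>N\<close>
  covers predicates \<open>P\<close> that are not measurable.\<close>

lemma AE_lborel_uminus:
  fixes P :: "real \<Rightarrow> bool"
  assumes "AE x in lborel. P x"
  shows "AE x in lborel. P (- x)"
proof -
  obtain N where N: "N \<in> null_sets lborel" "{x. \<not> P x} \<subseteq> N"
    using assms by (auto simp: eventually_ae_filter)
  then have [measurable]: "N \<in> sets borel" by (auto simp: null_sets_def)
  have "AE x in lborel. - x \<notin> N"
    using AE_borel_affine[of "- 1" "\<lambda>x. x \<notin> N" 0] AE_not_in[OF N(1)] by simp
  then show ?thesis
    by eventually_elim (use N in auto)
qed

theorem theorem4p3:
  fixes M :: "'w measure"
    and L :: "real \<Rightarrow> 'w \<Rightarrow> real"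
    and J :: "(real \<Rightarrow> real) \<Rightarrow> 'w \<Rightarrow> real"
    and g :: "real \<Rightarrow> real"
    and \<alpha> d C0 c \<theta>\<^sub>1 \<theta>\<^sub>2 :: real
  assumes "sas_process M \<alpha> L"
    and "stable_integral M \<alpha> L J"
    and "1 < \<alpha>" "\<alpha> < 2"
    and "0 < d" "d < 1 - 1 / \<alpha>"
    and "g \<in> borel_measurable lebesgue"
    and "\<And>t. t < 0 \<Longrightarrow> g t = 0"
    and "C0 > 0" "c > 0"
    and "\<And>t. \<bar>g t\<bar> \<le> C0 * exp (- c * t)"
  shows "let K = exp (- ((\<bar>\<theta>\<^sub>1\<bar> powr \<alpha> + \<bar>\<theta>\<^sub>2\<bar> powr \<alpha>) / Gamma d powr \<alpha> *
                   (LINT x:{..0}|lebesgue.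
                      \<bar>LINT u:{x..0}|lebesgue. g (- u) * (u - x) powr (d - 1)\<bar> powr \<alpha>)));
             C = \<bar>1 / Gamma d * (LINT u:{0..}|lebesgue. g u)\<bar> powr \<alpha> *
                   (LINT x:{1..}|lebesgue.
                      \<bar>\<theta>\<^sub>1 * (x - 1) powr (d - 1) + \<theta>\<^sub>2 * x powr (d - 1)\<bar> powr \<alpha>
                      - \<bar>\<theta>\<^sub>1 * (x - 1) powr (d - 1)\<bar> powr \<alpha>
                      - \<bar>\<theta>\<^sub>2 * x powr (d - 1)\<bar> powr \<alpha>)
         in ((\<lambda>t. complex_of_real (\<bar>t\<bar> powr (\<alpha> * (1 - d) - 1)) *
                    dependence_r M (fima_process J d g) \<theta>\<^sub>1 \<theta>\<^sub>2 t)
               \<longlongrightarrow> complex_of_real (- (K * C))) at_bot"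
proof -
  define p where "p t = C0 * exp (- c * t)" for t :: real
  obtain g' where g' [measurable]: "g' \<in> borel_measurable borel" and gg': "AE t in lborel. g t = g' t"
    using completion_ex_borel_measurable_real[OF assms(7)] by auto
  \<comment> \<open>Clamping \<open>g'\<close> between \<open>- p\<close> and \<open>p\<close> and
    setting it to 0 on the negative axis makes the bounds hold everywhere; where \<open>g'\<close>
    agrees with \<open>g\<close> nothing changes.\<close>
  define h where "h t = (if t < 0 then 0 else max (- p t) (min (p t) (g' t)))" for t
  have gh: "AE t in lborel. g t = h t"
    using gg'
  proof eventually_elim
    case (elim t)
    then show ?case using assms(8)[of t] assms(11)[of t] by (auto simp: h_def p_def)
  qed
  have p_nonneg: "0 \<le> p t" for t
    using \<open>C0 > 0\<close> by (simp add: p_def)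
  have "d < 1"
    using \<open>d < 1 - 1 / \<alpha>\<close> \<open>1 < \<alpha>\<close> by (smt (verit) divide_pos_pos)
  interpret exp_bounded_kernel h d c C0
  proof
    show "h \<in> borel_measurable borel" unfolding h_def p_def by measurable
    show "\<bar>h t\<bar> \<le> C0 * exp (- c * t)" for t
      using p_nonneg[of t] unfolding h_def p_def by auto
  qed (use assms \<open>d < 1\<close> in \<open>auto simp: h_def\<close>)
  \<comment> \<open>Each value is an integral, so the fractional integrals agree at every point, not
    just almost everywhere; both processes then apply \<open>J\<close> to the same function.\<close>
  have frac: "frac_integral d g = G"
  proof
    fix x
    have "(LINT t:{..x}|lebesgue. g t * (x - t) powr (d - 1)) =
        (\<integral>t. indicator {..x} t * (h t * (x - t) powr (d - 1)) \<partial>lborel)"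
      using assms(7) gh by (intro set_integral_lebesgue_cong) auto
    then show "frac_integral d g x = G x"
      by (simp only: frac_integral_def[of d g] frac_integral_lborel[OF g_measurable])
  qed
  then have Y: "fima_process J d g = fima_process J d h"
    by (simp add: fima_process_def fun_eq_iff)
  have "(LINT u:{0..}|lebesgue. g u * 1) = (\<integral>u. indicator {0..} u * (h u * 1) \<partial>lborel)"
    using assms(7) gh by (intro set_integral_lebesgue_cong) auto
  also have "\<dots> = (\<integral>u. h u \<partial>lborel)"
    by (intro Bochner_Integration.integral_cong) (auto simp: indicator_def h_def)
  finally have mass: "(LINT u:{0..}|lebesgue. g u) = (\<integral>u. h u \<partial>lborel)"
    by simp
  have inner: "(LINT u:{x..0}|lebesgue. g (- u) * (u - x) powr (d - 1)) = Gamma d * G (- x)" for x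
  proof -
    \<comment> \<open>Reflection is measurable between Lebesgue sigma-algebras, which a general
      Borel map need not be; this makes \<open>g (- u)\<close> Lebesgue measurable.\<close>
    have "(\<lambda>u. - 1 *\<^sub>R u) \<in> lebesgue \<rightarrow>\<^sub>M (lebesgue :: real measure)"
      by (rule lebesgue_measurable_scaling)
    then have "(\<lambda>u. g (- 1 *\<^sub>R u)) \<in> borel_measurable lebesgue"
      using assms(7) by (rule measurable_compose)
    then have "(LINT u:{x..0}|lebesgue. g (- u) * (u - x) powr (d - 1)) =
        (\<integral>u. indicator {x..0} u * (h (- u) * (u - x) powr (d - 1)) \<partial>lborel)"
      using AE_lborel_uminus[OF gh] by (intro set_integral_lebesgue_cong) auto
    also have "\<dots> = (\<integral>t. indicator {x..0} (- t) * (h t * (- x - t) powr (d - 1)) \<partial>lborel)"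
      by (subst lborel_integral_real_affine[of "- 1" _ 0]) (simp_all add: add.commute)
    also have "\<dots> = (\<integral>t. indicator {0..- x} t * (h t * (- x - t) powr (d - 1)) \<partial>lborel)"
      by (intro Bochner_Integration.integral_cong) (auto simp: indicator_def)
    also have "\<dots> = Gamma d * G (- x)"
      using Gamma_d_pos by (simp add: G_eq)
    finally show ?thesis .
  qed
  have "(LINT x:{..0}|lebesgue. \<bar>LINT u:{x..0}|lebesgue. g (- u) * (u - x) powr (d - 1)\<bar> powr \<alpha>) =
      (\<integral>x. Gamma d powr \<alpha> * (indicator {..0} x * \<bar>G (- x)\<bar> powr \<alpha>) \<partial>lborel)"
    unfolding inner unfolding set_lebesgue_integral_def
    using Gamma_d_pos by (simp add: integral_completion abs_mult powr_mult mult.left_commute)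
  also have "\<dots> = Gamma d powr \<alpha> * (\<integral>x. \<bar>G (0 - x)\<bar> powr \<alpha> \<partial>lborel)"
    unfolding integral_mult_right_zero
    by (intro arg_cong[where f = "(*) _"] Bochner_Integration.integral_cong) (auto simp: indicator_def G_neg)
  \<comment> \<open>The factor \<open>Gamma d powr \<alpha>\<close> cancels the divisor in
    \<open>K\<close>.\<close>
  finally have outer: "(LINT x:{..0}|lebesgue.
      \<bar>LINT u:{x..0}|lebesgue. g (- u) * (u - x) powr (d - 1)\<bar> powr \<alpha>) =
      Gamma d powr \<alpha> * (\<integral>x. \<bar>G x\<bar> powr \<alpha> \<partial>lborel)"
    by (simp only: integral_G_shift)
  have limit_integral: "(LINT x:{1..}|lebesgue.
      \<bar>\<theta>\<^sub>1 * (x - 1) powr (d - 1) + \<theta>\<^sub>2 * x powr (d - 1)\<bar> powr \<alpha>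
        - \<bar>\<theta>\<^sub>1 * (x - 1) powr (d - 1)\<bar> powr \<alpha> - \<bar>\<theta>\<^sub>2 * x powr (d - 1)\<bar> powr \<alpha>) =
      (\<integral>x. indicator {1..} x * codiff \<alpha> (\<theta>\<^sub>1 * (x - 1) powr (d - 1)) (\<theta>\<^sub>2 * x powr (d - 1)) \<partial>lborel)"
    unfolding set_lebesgue_integral_def codiff_def by (simp add: integral_completion)
  have "1 < \<alpha> * (1 - d)"
    using \<open>d < 1 - 1 / \<alpha>\<close> \<open>1 < \<alpha>\<close> by (simp add: field_simps)
  from tendsto_dependence_r[OF assms(2) \<open>1 < \<alpha>\<close> \<open>\<alpha> < 2\<close> this]
  show ?thesis
    using Gamma_d_pos unfolding Let_def Y mass outer limit_integral by simp
qed

end
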